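(* Let $k\ge 2$ be an integer. For every integer $n\ge 0$, the number of partitions of $n$ satisfying condition (P) equals the number of partitions of $n$ satisfying condition (S), where: (P) every part is either even and $\not\equiv 2\pmod{4k}$, or odd and $\equiv 1$ or $2k+1 \pmod{4k}$. (S) if an odd part $2j+1$ is present, then none of the other parts are equal to any of $2j+1,2j+2,\dots,2j+2k-1$. Moreover, the generating function of the partitions satisfying (P) is the periodic infinite product $\prod_m(1-q^m)^{-1}$ over all $m\ge 1$ that are even and $\not\equiv 2\pmod{4k}$ or are $\equiv 1,2k+1\pmod{4k}$.
   Context: Partitions have positive integer parts. In condition (S), "other parts" means all parts of the partition apart from the one occurrence of $2j+1$ under consideration; in particular, no odd part is repeated. The forbidden list $2j+1,2j+2,\dots,2j+2k-1$ consists of all consecutive integers in that range. *)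

theory Defs
  imports
    "HOL-Analysis.Analysis"
    "HOL-Computational_Algebra.Formal_Power_Series"
    "HOL-Library.Multiset"
    "HOL-Number_Theory.Cong"
begin

definition partitions_of :: "nat \<Rightarrow> nat multiset set" where
  "partitions_of n = {M. 0 \<notin># M \<and> \<Sum>\<^sub># M = n}"

definition condP :: "nat \<Rightarrow> nat multiset \<Rightarrow> bool" where
  "condP k M \<longleftrightarrow>
     (\<forall>p \<in># M. even p \<and> \<not> [p = 2] (mod 4 * k) \<or>
        odd p \<and> ([p = 1] (mod 4 * k) \<or> [p = 2 * k + 1] (mod 4 * k)))"

text \<open>
  The other parts are those left after removing a single occurrence of \<open>2 * j + 1\<close>, so a
  second copy of that part counts as another part and is forbidden.
\<close>
definition condS :: "nat \<Rightarrow> nat multiset \<Rightarrow> bool" where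
  "condS k M \<longleftrightarrow>
     (\<forall>j. 2 * j + 1 \<in># M \<longrightarrow>
        (\<forall>p \<in># M - {#2 * j + 1#}. p \<notin> {2 * j + 1..2 * j + 2 * k - 1}))"

definition P_indices :: "nat \<Rightarrow> nat set" where
  "P_indices k = {m. m \<ge> 1 \<and>
     (even m \<and> \<not> [m = 2] (mod 4 * k) \<or> [m = 1] (mod 4 * k) \<or> [m = 2 * k + 1] (mod 4 * k))}"

definition P_genfun :: "nat \<Rightarrow> rat fps" where
  "P_genfun k = Abs_fps (\<lambda>n. of_nat (card {M \<in> partitions_of n. condP k M}))"

end

theory Submission
  imports Defs
begin

unbundle fps_syntax and no vec_syntax

text \<open>
  Both sides are compared through the power series
    \<open>h\<^sub>n = \<Prod>i<n. (1 + q^(2ki+1)) / (1 - q^(2i+2))\<close>.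

  Condition (P). Since \<open>1 + q^(2ki+1) = (1 - q^(2(2ki+1))) / (1 - q^(2ki+1))\<close>, the numerators of
  \<open>h\<^sub>n\<close> become the factors \<open>1 - q^m\<close> with \<open>m \<equiv> 2 (mod 4k)\<close>. They cancel such factors of the
  denominator, and the new denominators contribute the parts \<open>\<equiv> 1, 2k+1 (mod 4k)\<close>. So \<open>h\<^sub>n\<close> tends
  to the generating function of (P); this is \<open>hcoeff_eq_P_genfun\<close>.

  Condition (S). Let \<open>B\<^sub>j\<close> be the generating function of the partitions satisfying (S) with all
  parts \<open>\<ge> 2j\<close>. If the least part is \<open>2j+1\<close>, then (S) demands that all other parts are
  \<open>\<ge> 2(j+k)\<close>, and conversely this is all that \<open>2j+1\<close> demands. Deciding whether \<open>2j\<close> and \<open>2j+1\<close> occur gives,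
  for \<open>j \<ge> 1\<close>,
    \<open>(1 - q^(2j)) B\<^sub>j = B\<^sub>j\<^sub>+\<^sub>1 + q^(2j+1) B\<^sub>j\<^sub>+\<^sub>k\<close>,
  while for \<open>j = 0\<close> the right-hand side \<open>B\<^sub>1 + q B\<^sub>k\<close> counts all partitions satisfying (S).
  Looking for \<open>B\<^sub>j\<close> as a power series \<open>\<Sum>n. h\<^sub>n x^n\<close> in \<open>x = q^(2j)\<close> turns this into
  \<open>h\<^sub>n\<^sub>+\<^sub>1 (1 - q^(2n+2)) = h\<^sub>n (1 + q^(2kn+1))\<close>, which is the series above. For the partial sum
  over \<open>n < N\<close> the recurrence holds for every \<open>j\<close>, up to an error \<open>q^(2jN) h\<^sub>N (1 - q^(2N))\<close>
  (\<open>hsum_recurrence\<close>). If \<open>j \<ge> 1\<close> the error is invisible in degrees below \<open>2N\<close>, so the partial sum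
  agrees with \<open>B\<^sub>j\<close> there (\<open>S_gf_eq_hsum\<close>). At \<open>j = 0\<close> the factor \<open>1 - q^(2j)\<close> vanishes and only the
  error survives: \<open>B\<^sub>1 + q B\<^sub>k\<close> agrees with \<open>h\<^sub>N\<close> in degrees below \<open>2N\<close> (\<open>S_gf_eq_hcoeff\<close>).
\<close>

section \<open>Generating functions of restricted partitions\<close>

definition part_gf :: "(nat multiset \<Rightarrow> bool) \<Rightarrow> rat fps" where
  "part_gf R = Abs_fps (\<lambda>n. of_nat (card {M \<in> partitions_of n. R M}))"

lemma part_le: "M \<in> partitions_of n \<Longrightarrow> p \<in># M \<Longrightarrow> p \<le> n"
  using sum_mset.remove[of p M] by (auto simp: partitions_of_def)

lemma part_pos: "M \<in> partitions_of n \<Longrightarrow> p \<in># M \<Longrightarrow> p > 0"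
  by (auto simp: partitions_of_def intro: gr0I)

lemma size_le_sum_mset: "(\<And>p. p \<in># M \<Longrightarrow> p > 0) \<Longrightarrow> size M \<le> \<Sum>\<^sub># M"
  for M :: "nat multiset"
proof (induction M)
  case (add x M)
  then have "x > 0" "size M \<le> \<Sum>\<^sub># M" by auto
  then show ?case by simp
qed simp

lemma finite_partitions_of [simp]: "finite (partitions_of n)"
proof (rule finite_subset)
  show "partitions_of n \<subseteq> (\<lambda>xs. mset xs) ` {xs. set xs \<subseteq> {..n} \<and> length xs \<le> n}"
  proof
    fix M assume M: "M \<in> partitions_of n"
    obtain xs where xs: "mset xs = M" by (metis ex_mset)
    have "size M \<le> \<Sum>\<^sub># M"
      using M part_pos[OF M] by (intro size_le_sum_mset) auto
    then have "length xs \<le> n"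
      using M unfolding xs[symmetric] by (simp add: partitions_of_def)
    moreover have "set xs \<subseteq> {..n}"
      using part_le[OF M] xs by auto
    ultimately show "M \<in> (\<lambda>xs. mset xs) ` {xs. set xs \<subseteq> {..n} \<and> length xs \<le> n}"
      using xs by blast
  qed
  show "finite ((\<lambda>xs. mset xs) ` {xs. set xs \<subseteq> {..n} \<and> length xs \<le> n})"
    by (intro finite_imageI finite_lists_length_le) auto
qed

lemma part_gf_nth_cong:
  assumes "\<And>M. M \<in> partitions_of n \<Longrightarrow> R M \<longleftrightarrow> R' M"
  shows "part_gf R $ n = part_gf R' $ n"
proof -
  have "{M \<in> partitions_of n. R M} = {M \<in> partitions_of n. R' M}"
    using assms by blast
  then show ?thesis by (simp add: part_gf_def)
qed

lemma part_gf_nth_0: "R {#} \<Longrightarrow> part_gf R $ 0 = 1"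
proof -
  assume "R {#}"
  moreover have "partitions_of 0 = {{#}}"
    by (auto simp: partitions_of_def) (metis multiset_nonemptyE)
  ultimately have "{M \<in> partitions_of 0. R M} = {{#}}" by auto
  then show ?thesis by (simp add: part_gf_def)
qed

text \<open>
  Every recurrence below comes from this step: removing one copy of \<open>a\<close> is a bijection from the
  partitions of \<open>n\<close> that contain \<open>a\<close> to the partitions of \<open>n - a\<close>.
\<close>

lemma part_gf_split:
  assumes "a > 0"
  shows "part_gf R = part_gf (\<lambda>M. R M \<and> a \<notin># M) + fps_X ^ a * part_gf (\<lambda>M. R (add_mset a M))"
proof (rule fps_ext)
  fix n
  let ?A = "{M \<in> partitions_of n. R M}"
  let ?B = "{M \<in> partitions_of n. R M \<and> a \<notin># M}"
  let ?C = "{M \<in> partitions_of n. R M \<and> a \<in># M}"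
  let ?D = "{M \<in> partitions_of (n - a). R (add_mset a M)}"
  have "?A = ?B \<union> ?C" by auto
  then have A: "card ?A = card ?B + card ?C"
    by (simp add: card_Un_disjoint disjoint_iff)
  have C: "card ?C = (if n < a then 0 else card ?D)"
  proof (cases "n < a")
    case True
    then have "?C = {}" using part_le by fastforce
    then show ?thesis using True by (metis card.empty)
  next
    case False
    have "bij_betw (add_mset a) ?D ?C"
      unfolding bij_betw_def
    proof
      show "add_mset a ` ?D = ?C"
      proof (intro subset_antisym subsetI)
        fix M assume M: "M \<in> ?C"
        then obtain M' where "M = add_mset a M'" by (auto dest: multi_member_split)
        then show "M \<in> add_mset a ` ?D" using M by (auto simp: partitions_of_def)
      qed (use False assms in \<open>auto simp: partitions_of_def\<close>)
    qed (simp add: inj_on_def)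
    then show ?thesis using False by (simp add: bij_betw_same_card)
  qed
  show "part_gf R $ n = (part_gf (\<lambda>M. R M \<and> a \<notin># M)
          + fps_X ^ a * part_gf (\<lambda>M. R (add_mset a M))) $ n"
    unfolding part_gf_def by (simp add: fps_X_power_mult_nth A C)
qed

section \<open>Parts from a prescribed set\<close>

lemma part_gf_finite_parts:
  assumes "finite T" "0 \<notin> T"
  shows "part_gf (\<lambda>M. set_mset M \<subseteq> T) * (\<Prod>t\<in>T. 1 - fps_X ^ t) = 1"
  using assms
proof (induction T rule: finite_induct)
  case empty
  have "part_gf (\<lambda>M. set_mset M \<subseteq> {}) $ n = 1 $ n" for n
  proof (cases "n = 0")
    case False
    then have "{M \<in> partitions_of n. M = {#}} = {}" by (auto simp: partitions_of_def)
    then show ?thesis using False by (simp add: part_gf_def)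
  qed (simp add: part_gf_nth_0)
  then show ?case by (simp add: fps_eq_iff)
next
  case (insert t T)
  let ?F = "\<lambda>T. part_gf (\<lambda>M. set_mset M \<subseteq> T)"
  have "?F (insert t T) = part_gf (\<lambda>M. set_mset M \<subseteq> insert t T \<and> t \<notin># M)
      + fps_X ^ t * part_gf (\<lambda>M. set_mset (add_mset t M) \<subseteq> insert t T)"
    using insert by (intro part_gf_split) auto
  also have "(\<lambda>M. set_mset M \<subseteq> insert t T \<and> t \<notin># M) = (\<lambda>M. set_mset M \<subseteq> T)"
    using insert by (auto simp: fun_eq_iff)
  finally have "?F (insert t T) * (1 - fps_X ^ t) = ?F T"
    by (simp add: algebra_simps)
  then show ?case using insert by (simp add: mult.assoc[symmetric])
qed

text \<open>
  Parts exceeding \<open>n\<close> do not occur in partitions of \<open>n\<close>. Infinite sets of allowed parts can thus be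
  replaced by finite ones, degree by degree.
\<close>

lemma part_gf_parts_nth_cong:
  assumes "T \<inter> {..n} = U \<inter> {..n}" "i \<le> n"
  shows "part_gf (\<lambda>M. set_mset M \<subseteq> T) $ i = part_gf (\<lambda>M. set_mset M \<subseteq> U) $ i"
proof (rule part_gf_nth_cong)
  fix M assume M: "M \<in> partitions_of i"
  have "set_mset M \<subseteq> {..n}" using part_le[OF M] assms(2) by fastforce
  then show "set_mset M \<subseteq> T \<longleftrightarrow> set_mset M \<subseteq> U" using assms(1) by blast
qed

lemma P_genfun_eq:
  assumes "k \<ge> 1"
  shows "P_genfun k = part_gf (\<lambda>M. set_mset M \<subseteq> P_indices k)"
proof (rule fps_ext)
  fix n
  have odd1: "odd p" if "[p = 1] (mod 4 * k)" for p :: nat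
    using cong_dvd_modulus_nat[OF that, of 2] by (auto simp: cong_def odd_iff_mod_2_eq_one)
  have odd2: "odd p" if "[p = 2 * k + 1] (mod 4 * k)" for p :: nat
    using cong_dvd_modulus_nat[OF that, of 2] by (auto simp: cong_def odd_iff_mod_2_eq_one)
  have "part_gf (condP k) $ n = part_gf (\<lambda>M. set_mset M \<subseteq> P_indices k) $ n"
  proof (rule part_gf_nth_cong)
    fix M assume "M \<in> partitions_of n"
    then have "p \<ge> 1" if "p \<in># M" for p
      using that by (cases p) (auto simp: partitions_of_def)
    then show "condP k M \<longleftrightarrow> set_mset M \<subseteq> P_indices k"
      using odd1 odd2 by (auto simp: condP_def P_indices_def)
  qed
  then show "P_genfun k $ n = part_gf (\<lambda>M. set_mset M \<subseteq> P_indices k) $ n"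
    by (simp add: P_genfun_def part_gf_def)
qed

lemma P_genfun_has_prod:
  assumes "k \<ge> 1"
  shows "(\<lambda>m. if m \<in> P_indices k then inverse (1 - fps_X ^ m) else 1) has_prod P_genfun k"
proof -
  let ?f = "\<lambda>m. if m \<in> P_indices k then inverse (1 - fps_X ^ m) else 1 :: rat fps"
  let ?T = "\<lambda>n. P_indices k \<inter> {..n}"
  have partial: "(\<Prod>m\<le>n. ?f m) = part_gf (\<lambda>M. set_mset M \<subseteq> ?T n)" for n
  proof -
    have "part_gf (\<lambda>M. set_mset M \<subseteq> ?T n) * (\<Prod>m\<in>?T n. 1 - fps_X ^ m) = 1"
      by (intro part_gf_finite_parts) (auto simp: P_indices_def)
    then have "inverse (\<Prod>m\<in>?T n. 1 - fps_X ^ m) = part_gf (\<lambda>M. set_mset M \<subseteq> ?T n)"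
      by (intro fps_inverse_unique) (simp add: mult.commute)
    moreover have "(\<Prod>m\<le>n. ?f m) = (\<Prod>m\<in>?T n. inverse (1 - fps_X ^ m))"
      by (simp add: prod.If_cases Int_commute)
    ultimately show ?thesis by (simp add: inverse_prod_fps)
  qed
  have "(\<lambda>n. \<Prod>m\<le>n. ?f m) \<longlonglongrightarrow> P_genfun k"
  proof (rule tendsto_fpsI)
    fix i
    show "\<forall>\<^sub>F n in sequentially. (\<Prod>m\<le>n. ?f m) $ i = P_genfun k $ i"
      unfolding partial P_genfun_eq[OF assms]
      using eventually_ge_at_top[of i]
      by eventually_elim (rule part_gf_parts_nth_cong, auto)
  qed
  moreover have "P_genfun k $ 0 = 1"
    unfolding P_genfun_eq[OF assms] by (rule part_gf_nth_0) simp
  then have "P_genfun k \<noteq> 0" by auto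
  ultimately have "raw_has_prod ?f 0 (P_genfun k)"
    unfolding raw_has_prod_def add_0_right by blast
  then show ?thesis unfolding has_prod_def by (rule disjI1)
qed

section \<open>Recurrences for condition (S)\<close>

definition S_gf :: "nat \<Rightarrow> nat \<Rightarrow> rat fps" where
  "S_gf k l = part_gf (\<lambda>M. condS k M \<and> (\<forall>p\<in>#M. l \<le> p))"


text \<open>
  An odd part only forbids values from itself upwards, so an even part that is at most all others
  is never forbidden, and being even it forbids nothing.
\<close>

lemma condS_add_even:
  assumes "\<And>p. p \<in># M \<Longrightarrow> 2 * j \<le> p"
  shows "condS k (add_mset (2 * j) M) \<longleftrightarrow> condS k M"
proof -
  have "(\<forall>p\<in>#add_mset (2 * j) M - {#2 * i + 1#}. p \<notin> {2 * i + 1..2 * i + 2 * k - 1})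
      \<longleftrightarrow> (\<forall>p\<in>#M - {#2 * i + 1#}. p \<notin> {2 * i + 1..2 * i + 2 * k - 1})"
    if "2 * i + 1 \<in># M" for i
  proof -
    have "add_mset (2 * j) M - {#2 * i + 1#} = add_mset (2 * j) (M - {#2 * i + 1#})"
      using that by simp
    moreover have "2 * j < 2 * i + 1"
      using assms[OF that] by presburger
    ultimately show ?thesis by auto
  qed
  moreover have "2 * i + 1 \<in># add_mset (2 * j) M \<longleftrightarrow> 2 * i + 1 \<in># M" for i
  proof -
    have "2 * i + 1 \<noteq> 2 * j" by presburger
    then show ?thesis by simp
  qed
  ultimately show ?thesis
    unfolding condS_def by blast
qed

text \<open>
  The values that \<open>2j+1\<close> forbids are exactly those from \<open>2j+1\<close> up to \<open>2(j+k) - 1\<close>. The larger odd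
  parts do not see it.
\<close>

lemma condS_add_odd:
  assumes "k \<ge> 1"
  shows "condS k (add_mset (2 * j + 1) M) \<and> (\<forall>p\<in>#M. 2 * j + 1 \<le> p)
     \<longleftrightarrow> condS k M \<and> (\<forall>p\<in>#M. 2 * (j + k) \<le> p)"
    (is "?l \<longleftrightarrow> ?r")
proof
  assume l: ?l
  have "2 * (j + k) \<le> p" if "p \<in># M" for p
  proof -
    have "p \<notin> {2 * j + 1..2 * j + 2 * k - 1}" "2 * j + 1 \<le> p"
      using l that unfolding condS_def by (metis add_mset_remove_trivial union_single_eq_member, blast)
    then show ?thesis by simp
  qed
  moreover have "condS k M"
    unfolding condS_def
  proof (intro allI impI ballI)
    fix i p
    assume i: "2 * i + 1 \<in># M" and p: "p \<in># M - {#2 * i + 1#}"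
    have "p \<in># add_mset (2 * j + 1) M - {#2 * i + 1#}"
      using i p by (metis diff_union_swap2 insert_noteq_member insertE set_mset_add_mset_insert insertI2)
    then show "p \<notin> {2 * i + 1..2 * i + 2 * k - 1}"
      using l i unfolding condS_def by auto
  qed
  ultimately show ?r by blast
next
  assume r: ?r
  have "condS k (add_mset (2 * j + 1) M)"
    unfolding condS_def
  proof (intro allI impI ballI)
    fix i p
    assume i: "2 * i + 1 \<in># add_mset (2 * j + 1) M"
      and p: "p \<in># add_mset (2 * j + 1) M - {#2 * i + 1#}"
    show "p \<notin> {2 * i + 1..2 * i + 2 * k - 1}"
    proof (cases "i = j")
      case True
      then have "2 * (j + k) \<le> p" using p r by simp
      then show ?thesis using True assms by auto
    next
      case False
      then have M: "2 * i + 1 \<in># M" using i by auto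
      then have "2 * (j + k) \<le> 2 * i + 1" using r by blast
      then have "2 * j + 1 < 2 * i + 1" using assms by presburger
      moreover have "p = 2 * j + 1 \<or> p \<in># M - {#2 * i + 1#}"
        using p M False by auto
      ultimately show ?thesis using r M unfolding condS_def by auto
    qed
  qed
  then show ?l using r assms by fastforce
qed

text \<open>For \<open>j = 0\<close> the identity fails, as \<open>0\<close> is not a possible part.\<close>

lemma S_gf_even:
  assumes "j \<ge> 1"
  shows "S_gf k (2 * j) = S_gf k (2 * j + 1) + fps_X ^ (2 * j) * S_gf k (2 * j)"
proof -
  have "S_gf k (2 * j) =
      part_gf (\<lambda>M. (condS k M \<and> (\<forall>p\<in>#M. 2 * j \<le> p)) \<and> 2 * j \<notin># M)
      + fps_X ^ (2 * j) * part_gf (\<lambda>M. condS k (add_mset (2 * j) M)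
          \<and> (\<forall>p\<in>#add_mset (2 * j) M. 2 * j \<le> p))"
    unfolding S_gf_def by (rule part_gf_split) (use assms in auto)
  also have "(\<lambda>M. (condS k M \<and> (\<forall>p\<in>#M. 2 * j \<le> p)) \<and> 2 * j \<notin># M)
      = (\<lambda>M. condS k M \<and> (\<forall>p\<in>#M. 2 * j + 1 \<le> p))"
    by (auto simp: fun_eq_iff Suc_le_eq le_less)
  also have "(\<lambda>M. condS k (add_mset (2 * j) M) \<and> (\<forall>p\<in>#add_mset (2 * j) M. 2 * j \<le> p))
      = (\<lambda>M. condS k M \<and> (\<forall>p\<in>#M. 2 * j \<le> p))"
    using condS_add_even[of _ j k] by (auto simp: fun_eq_iff)
  finally show ?thesis by (simp add: S_gf_def)
qed

lemma S_gf_odd: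
  assumes "k \<ge> 1"
  shows "S_gf k (2 * j + 1) =
    S_gf k (2 * (j + 1)) + fps_X ^ (2 * j + 1) * S_gf k (2 * (j + k))"
proof -
  have "S_gf k (2 * j + 1) =
      part_gf (\<lambda>M. (condS k M \<and> (\<forall>p\<in>#M. 2 * j + 1 \<le> p)) \<and> 2 * j + 1 \<notin># M)
      + fps_X ^ (2 * j + 1) * part_gf (\<lambda>M. condS k (add_mset (2 * j + 1) M)
          \<and> (\<forall>p\<in>#add_mset (2 * j + 1) M. 2 * j + 1 \<le> p))"
    unfolding S_gf_def by (rule part_gf_split) simp
  also have "(\<lambda>M. (condS k M \<and> (\<forall>p\<in>#M. 2 * j + 1 \<le> p)) \<and> 2 * j + 1 \<notin># M)
      = (\<lambda>M. condS k M \<and> (\<forall>p\<in>#M. 2 * (j + 1) \<le> p))"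
    by (auto simp: fun_eq_iff Suc_le_eq le_less)
  also have "(\<lambda>M. condS k (add_mset (2 * j + 1) M)
          \<and> (\<forall>p\<in>#add_mset (2 * j + 1) M. 2 * j + 1 \<le> p))
      = (\<lambda>M. condS k M \<and> (\<forall>p\<in>#M. 2 * (j + k) \<le> p))"
    using condS_add_odd[OF assms, of j] by (auto simp: fun_eq_iff)
  finally show ?thesis by (simp add: S_gf_def)
qed

section \<open>Solving the recurrence\<close>

definition hcoeff :: "nat \<Rightarrow> nat \<Rightarrow> rat fps" where
  "hcoeff k n = (\<Prod>i<n. (1 + fps_X ^ (2 * k * i + 1)) * inverse (1 - fps_X ^ (2 * i + 2)))"

definition hsum :: "nat \<Rightarrow> nat \<Rightarrow> nat \<Rightarrow> rat fps" where
  "hsum k N j = (\<Sum>n<N. hcoeff k n * fps_X ^ (2 * j * n))"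

lemma inverse_one_minus_X_power:
  "m > 0 \<Longrightarrow> inverse (1 - fps_X ^ m) * (1 - fps_X ^ m) = (1 :: 'a :: field fps)"
  by (intro inverse_mult_eq_1) simp

lemma hcoeff_Suc:
  "hcoeff k (Suc n) * (1 - fps_X ^ (2 * Suc n)) = hcoeff k n * (1 + fps_X ^ (2 * k * n + 1))"
  using inverse_one_minus_X_power[of "2 * n + 2", where ?'a = rat]
  by (simp add: hcoeff_def mult.assoc del: power_Suc)

text \<open>
  The recurrence of \<open>S_gf_even\<close> and \<open>S_gf_odd\<close>, with the error caused by truncation as last
  summand. The coefficients of \<open>x^n\<close>, where \<open>x = q^(2j)\<close>, cancel by \<open>hcoeff_Suc\<close> except at \<open>n = N\<close>.
\<close>

lemma hsum_recurrence:
  "hsum k N (j + 1) + fps_X ^ (2 * j + 1) * hsum k N (j + k) =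
   (1 - fps_X ^ (2 * j)) * hsum k N j + fps_X ^ (2 * j * N) * (hcoeff k N * (1 - fps_X ^ (2 * N)))"
proof (induction N)
  case 0
  then show ?case by (simp add: hsum_def)
next
  case (Suc N)
  define x where "x = (fps_X ^ (2 * j) :: rat fps)"
  define y where "y = (fps_X ^ (2 * j * N) :: rat fps)"
  define u where "u = (fps_X ^ (2 * N) :: rat fps)"
  define w where "w = (fps_X ^ (2 * k * N) :: rat fps)"
  define h where "h = hcoeff k N"
  have S: "hsum k (Suc N) i = hsum k N i + h * fps_X ^ (2 * i * N)" for i
    by (simp add: hsum_def h_def)
  have p: "fps_X ^ (2 * (j + 1) * N) = y * u" "fps_X ^ (2 * (j + k) * N) = y * w"
    "fps_X ^ (2 * j * Suc N) = x * y" "fps_X ^ (2 * j + 1) = x * fps_X"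
    "fps_X ^ (2 * k * N + 1) = w * fps_X"
    by (simp_all add: x_def y_def u_def w_def algebra_simps flip: power_add power_Suc2)
  show ?case
    using Suc unfolding S p hcoeff_Suc unfolding x_def[symmetric] y_def[symmetric] u_def[symmetric] h_def[symmetric]
    by (simp add: algebra_simps)
qed

text \<open>
  The recurrence expresses degree \<open>m\<close> at \<open>j\<close> through lower degrees and through degree \<open>m\<close> at
  \<open>j + 1\<close>. Hence the induction goes upwards on \<open>m\<close> and, inside, downwards on \<open>j\<close>. It starts at
  \<open>2j > m\<close>, where both series look like the constant \<open>1\<close>.
\<close>

lemma S_gf_eq_hsum:
  assumes "k \<ge> 1" "j \<ge> 1" "m < 2 * N"
  shows "S_gf k (2 * j) $ m = hsum k N j $ m"
  using assms(2,3)
proof (induction m arbitrary: j rule: less_induct)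
  case (less m)
  have "S_gf k (2 * j) $ m = hsum k N j $ m" if "j \<ge> 1" for j
    using that
  proof (induction "m + 1 - j" arbitrary: j rule: less_induct)
    case (less j)
    show ?case
    proof (cases "m < 2 * j")
      case True
      have S: "S_gf k (2 * j) $ m = part_gf (\<lambda>M. set_mset M \<subseteq> {}) $ m"
        unfolding S_gf_def
      proof (rule part_gf_nth_cong)
        fix M assume "M \<in> partitions_of m"
        then have "M = {#}" if "\<forall>p\<in>#M. 2 * j \<le> p"
          using part_le[of M m] that True by (meson leD le_trans multiset_nonemptyE)
        then show "(condS k M \<and> (\<forall>p\<in>#M. 2 * j \<le> p)) \<longleftrightarrow> set_mset M \<subseteq> {}"
          by (auto simp: condS_def)
      qed
      have one: "part_gf (\<lambda>M. set_mset M \<subseteq> {}) = 1"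
        using part_gf_finite_parts[of "{}"] by simp
      have "hsum k N j $ m = (\<Sum>n<N. if n = 0 then 1 $ m else 0)"
        unfolding hsum_def fps_sum_nth
      proof (rule sum.cong)
        fix n
        have "m < 2 * j * n" if "n \<noteq> 0"
          using True that by (metis less_le_trans mult.right_neutral mult_le_mono2 One_nat_def Suc_leI neq0_conv)
        then show "(hcoeff k n * fps_X ^ (2 * j * n)) $ m = (if n = 0 then 1 $ m else 0)"
          by (simp add: hcoeff_def fps_X_power_mult_right_nth)
      qed simp
      then show ?thesis using S one \<open>m < 2 * N\<close> by simp
    next
      case False
      let ?D = "\<lambda>i. S_gf k (2 * i) - hsum k N i"
      let ?R = "fps_X ^ (2 * j * N) * (hcoeff k N * (1 - fps_X ^ (2 * N)))"
      have D: "?D j = fps_X ^ (2 * j) * ?D j + ?D (j + 1) + fps_X ^ (2 * j + 1) * ?D (j + k) + ?R"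
        using S_gf_even[OF \<open>j \<ge> 1\<close>, of k] S_gf_odd[OF assms(1), of j] hsum_recurrence[of k N j]
        by (simp add: algebra_simps)
      have "2 * N \<le> 2 * j * N" using \<open>j \<ge> 1\<close> by simp
      then have "m < 2 * j * N" using \<open>m < 2 * N\<close> by linarith
      then have "?R $ m = 0" by (simp only: fps_X_power_mult_nth if_True)
      moreover have "(fps_X ^ (2 * j) * ?D j) $ m = 0"
        "(fps_X ^ (2 * j + 1) * ?D (j + k)) $ m = 0"
        unfolding fps_X_power_mult_nth
        using False less.prems \<open>m < 2 * N\<close>
          \<open>\<And>i j. i < m \<Longrightarrow> 1 \<le> j \<Longrightarrow> i < 2 * N \<Longrightarrow> S_gf k (2 * j) $ i = hsum k N j $ i\<close>
        by (simp_all del: power_Suc distrib_left_numeral)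
      moreover have "?D (j + 1) $ m = 0"
        using less.hyps[of "j + 1"] False less.prems by simp
      ultimately have "?D j $ m = 0"
        by (subst D) (simp del: power_Suc)
      then show ?thesis by simp
    qed
  qed
  then show ?case using less.prems by blast
qed

lemma one_minus_X_powers_mult_nth:
  fixes f :: "rat fps"
  assumes "finite A" "\<And>a. a \<in> A \<Longrightarrow> n < a"
  shows "((\<Prod>a\<in>A. 1 - fps_X ^ a) * f) $ n = f $ n"
  using assms
proof (induction A rule: finite_induct)
  case (insert a A)
  have "(\<Prod>a\<in>insert a A. 1 - fps_X ^ a) * f
      = (\<Prod>a\<in>A. 1 - fps_X ^ a) * f - fps_X ^ a * ((\<Prod>a\<in>A. 1 - fps_X ^ a) * f)"
    using insert by (simp add: algebra_simps)
  then show ?case using insert by (simp add: fps_X_power_mult_nth)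
qed simp

text \<open>
  The recurrence at \<open>j = 0\<close>: the sum telescopes to its error term, and \<open>1 - q^(2N)\<close> is \<open>1\<close> in the
  degrees considered.
\<close>

lemma S_gf_eq_hcoeff:
  assumes "k \<ge> 1" "m < 2 * N"
  shows "S_gf k 0 $ m = hcoeff k N $ m"
proof -
  have "S_gf k 0 $ m = S_gf k (2 * 0 + 1) $ m"
    unfolding S_gf_def
    by (rule part_gf_nth_cong) (auto simp: partitions_of_def Suc_le_eq intro!: gr0I)
  also have "\<dots> = S_gf k (2 * 1) $ m + (fps_X ^ 1 * S_gf k (2 * k)) $ m"
    using S_gf_odd[OF assms(1), of 0] by simp
  also have "\<dots> = hsum k N 1 $ m + (fps_X ^ 1 * hsum k N k) $ m"
    unfolding fps_X_power_mult_nth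
    using S_gf_eq_hsum[OF assms(1) _ assms(2), of 1] S_gf_eq_hsum[OF assms(1) assms(1), of "m - 1" N] assms(2)
    by simp
  also have "\<dots> = ((1 - fps_X ^ (2 * N)) * hcoeff k N) $ m"
    using arg_cong[OF hsum_recurrence[of k N 0], of "\<lambda>f. f $ m"] by (simp add: mult.commute)
  also have "\<dots> = hcoeff k N $ m"
    using one_minus_X_powers_mult_nth[of "{2 * N}" m "hcoeff k N"] assms by simp
  finally show ?thesis .
qed

section \<open>The product formula for condition (P)\<close>

lemma cong_less_iff_nat:
  fixes c :: nat
  assumes "c < m"
  shows "[a = c] (mod m) \<longleftrightarrow> (\<exists>i. a = c + m * i)"
proof
  assume "[a = c] (mod m)"
  then have "a mod m = c" using assms by (simp add: cong_def)
  then have "a = c + m * (a div m)" using mod_mult_div_eq[of a m] by simp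
  then show "\<exists>i. a = c + m * i" by blast
qed (use assms in \<open>auto simp: cong_def\<close>)

text \<open>
  The classes \<open>1\<close> and \<open>2k+1\<close> modulo \<open>4k\<close> form the class \<open>1\<close> modulo \<open>2k\<close>, and the excluded class
  \<open>2\<close> modulo \<open>4k\<close> is its double.
\<close>

lemma P_indices_iff:
  assumes "k \<ge> 1"
  shows "m \<in> P_indices k \<longleftrightarrow>
    (m \<ge> 1 \<and> even m \<and> (\<forall>i. m \<noteq> 2 * (2 * k * i + 1))) \<or> (\<exists>i. m = 2 * k * i + 1)"
proof -
  have "[m = 2] (mod 4 * k) \<longleftrightarrow> (\<exists>i. m = 2 * (2 * k * i + 1))"
    using assms by (subst cong_less_iff_nat) auto
  moreover have "[m = 1] (mod 4 * k) \<or> [m = 2 * k + 1] (mod 4 * k) \<longleftrightarrow> (\<exists>i. m = 2 * k * i + 1)"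
  proof -
    have "[m = 1] (mod 4 * k) \<longleftrightarrow> (\<exists>i. m = 2 * k * (2 * i) + 1)"
      using assms by (subst cong_less_iff_nat) auto
    moreover have "[m = 2 * k + 1] (mod 4 * k) \<longleftrightarrow> (\<exists>i. m = 2 * k * (2 * i + 1) + 1)"
      using assms by (subst cong_less_iff_nat) (auto simp: algebra_simps)
    ultimately show ?thesis by (metis evenE oddE)
  qed
  ultimately show ?thesis by (auto simp: P_indices_def)
qed

text \<open>
  Writing \<open>Od\<close>, \<open>E\<close>, \<open>A\<close> for the first \<open>N\<close> odd parts, even numbers and doubles of the odd parts,
  \<open>h\<^sub>N\<close> is the product of \<open>1 - q^a\<close> over \<open>A\<close>, divided by those over \<open>Od\<close> and \<open>E\<close>. After cancelling
  \<open>A \<inter> E\<close> the denominator ranges over \<open>T = (E - A) \<union> Od\<close>, which has the same elements up to \<open>N\<close> as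
  the set of parts allowed by (P), and the numerator over \<open>A - E\<close>, whose elements exceed \<open>2N\<close>.
\<close>

lemma hcoeff_eq_P_genfun:
  assumes "k \<ge> 1" "m \<le> N"
  shows "hcoeff k N $ m = P_genfun k $ m"
proof -
  define Q where "Q = (\<lambda>A. \<Prod>a\<in>A. 1 - fps_X ^ a :: rat fps)"
  define Od where "Od = (\<lambda>i. 2 * k * i + 1) ` {..<N}"
  define E where "E = (\<lambda>i. 2 * i + 2) ` {..<N}"
  define A where "A = (\<lambda>i. 2 * (2 * k * i + 1)) ` {..<N}"
  define T where "T = (E - A) \<union> Od"
  have fin [simp]: "finite Od" "finite E" "finite A" "finite T"
    by (simp_all add: Od_def E_def A_def T_def)
  have QOd: "Q Od = (\<Prod>i<N. 1 - fps_X ^ (2 * k * i + 1))"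
    and QE: "Q E = (\<Prod>i<N. 1 - fps_X ^ (2 * i + 2))"
    and QA: "Q A = (\<Prod>i<N. 1 - fps_X ^ (2 * (2 * k * i + 1)))"
    unfolding Q_def Od_def E_def A_def using assms
    by (simp_all add: prod.reindex inj_on_def del: power_Suc)
  have "hcoeff k N * Q Od * Q E = Q A"
    unfolding hcoeff_def QOd QE QA prod.distrib[symmetric]
  proof (rule prod.cong)
    fix i :: nat
    have pos: "2 * i + 2 > 0" by simp
    have sq: "(1 + y) * (1 - y) = 1 - y ^ 2" for y :: "rat fps"
      by (simp add: algebra_simps power2_eq_square)
    have "(1 + fps_X ^ (2 * k * i + 1)) * inverse (1 - fps_X ^ (2 * i + 2))
        * (1 - fps_X ^ (2 * k * i + 1)) * (1 - fps_X ^ (2 * i + 2))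
      = ((1 + fps_X ^ (2 * k * i + 1)) * (1 - fps_X ^ (2 * k * i + 1)))
        * (inverse (1 - fps_X ^ (2 * i + 2)) * (1 - fps_X ^ (2 * i + 2)) :: rat fps)"
      by (simp only: mult_ac)
    also have "\<dots> = 1 - fps_X ^ (2 * (2 * k * i + 1))"
      by (simp only: sq inverse_one_minus_X_power[of "2 * i + 2", OF pos] power_mult[symmetric]
          mult.commute[of _ 2] mult_1_right)
    finally show "(1 + fps_X ^ (2 * k * i + 1)) * inverse (1 - fps_X ^ (2 * i + 2))
        * (1 - fps_X ^ (2 * k * i + 1)) * (1 - fps_X ^ (2 * i + 2))
      = (1 - fps_X ^ (2 * (2 * k * i + 1)) :: rat fps)" .
  qed simp
  moreover have "Q E = Q (E - A) * Q (E \<inter> A)" "Q A = Q (A - E) * Q (E \<inter> A)"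
    using prod.Int_Diff[OF fin(2), of "\<lambda>a. 1 - fps_X ^ a :: rat fps" A]
      prod.Int_Diff[OF fin(3), of "\<lambda>a. 1 - fps_X ^ a :: rat fps" E]
    by (simp_all add: Q_def mult.commute Int_commute)
  moreover have "Q (E \<inter> A) \<noteq> 0"
  proof -
    have "(1 - fps_X ^ a :: rat fps) \<noteq> 0" if "a > 0" for a
      using inverse_one_minus_X_power[OF that, where ?'a = rat]
      by (metis mult_zero_right zero_neq_one)
    then show ?thesis by (auto simp: Q_def E_def)
  qed
  ultimately have "hcoeff k N * Q Od * Q (E - A) = Q (A - E)"
    by (metis mult.assoc mult_right_cancel)
  moreover have "Q T = Q (E - A) * Q Od"
  proof -
    have "even a" if "a \<in> E" for a using that by (auto simp: E_def)
    moreover have "odd a" if "a \<in> Od" for a using that by (auto simp: Od_def)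
    ultimately have "(E - A) \<inter> Od = {}" by blast
    then show ?thesis unfolding Q_def T_def by (intro prod.union_disjoint) auto
  qed
  ultimately have h: "hcoeff k N * Q T = Q (A - E)"
    by (simp add: mult_ac)
  let ?F = "\<lambda>T. part_gf (\<lambda>M. set_mset M \<subseteq> T)"
  have F: "?F T * Q T = 1"
    unfolding Q_def by (rule part_gf_finite_parts) (auto simp: T_def E_def Od_def)
  have "hcoeff k N = hcoeff k N * (?F T * Q T)" by (simp add: F)
  also have "\<dots> = Q (A - E) * ?F T" by (simp add: h[symmetric] mult_ac)
  finally have "hcoeff k N $ m = (Q (A - E) * ?F T) $ m" by simp
  also have "\<dots> = ?F T $ m"
    unfolding Q_def
  proof (rule one_minus_X_powers_mult_nth)
    fix a assume a: "a \<in> A - E"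
    then obtain i where i: "a = 2 * (2 * k * i + 1)" by (auto simp: A_def)
    have "2 * k * i \<ge> N"
    proof (rule ccontr)
      assume "\<not> 2 * k * i \<ge> N"
      then have "a \<in> E" using i by (auto simp: E_def intro!: image_eqI[of _ _ "2 * k * i"])
      then show False using a by blast
    qed
    moreover have "x < 2 * (y + 1)" if "x \<le> y" for x y :: nat
      using that by presburger
    ultimately show "m < a" unfolding i using assms(2) le_trans by blast
  qed simp
  also have "\<dots> = ?F (P_indices k) $ m"
  proof (rule part_gf_parts_nth_cong)
    have "a \<in> T \<longleftrightarrow> a \<in> P_indices k" if "a \<le> m" for a
    proof -
      have O: "a \<in> Od \<longleftrightarrow> (\<exists>i. a = 2 * k * i + 1)"
        and A: "a \<in> A \<longleftrightarrow> (\<exists>i. a = 2 * (2 * k * i + 1))"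
      proof -
        have le: "i \<le> 2 * k * i" for i using assms by simp
        have less: "y < N" if "a = x + 1 \<or> a = 2 * (x + 1)" "y \<le> x" for x y
        proof -
          have "x < a" using that(1) by auto
          then show ?thesis using that(2) \<open>a \<le> m\<close> assms(2) by simp
        qed
        have "i < N" if "a = 2 * k * i + 1" for i
          using less[OF _ le] that by blast
        then show "a \<in> Od \<longleftrightarrow> (\<exists>i. a = 2 * k * i + 1)" by (auto simp: Od_def)
        have "i < N" if "a = 2 * (2 * k * i + 1)" for i
          using less[OF _ le] that by blast
        then show "a \<in> A \<longleftrightarrow> (\<exists>i. a = 2 * (2 * k * i + 1))" by (auto simp: A_def)
      qed
      have E: "a \<in> E \<longleftrightarrow> a \<ge> 1 \<and> even a"
      proof
        assume "a \<ge> 1 \<and> even a"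
        then obtain b where b: "a = 2 * b" "b \<ge> 1" by (auto elim!: evenE)
        then show "a \<in> E"
          using that assms by (auto simp: E_def intro!: image_eqI[of _ _ "b - 1"])
      qed (auto simp: E_def)
      show ?thesis
        unfolding T_def P_indices_iff[OF assms(1)] using O A E by blast
    qed
    then show "T \<inter> {..m} = P_indices k \<inter> {..m}" by blast
  qed simp
  finally show ?thesis using assms P_genfun_eq[of k] by simp
qed

theorem mainTheorem10:
  fixes k :: nat
  assumes "k \<ge> 2"
  shows "(\<forall>n. card {M \<in> partitions_of n. condP k M} = card {M \<in> partitions_of n. condS k M})
    \<and> (\<lambda>m. if m \<in> P_indices k then inverse (1 - fps_X ^ m) else 1) has_prod P_genfun k
    \<and> (\<forall>m\<ge>1. m + 4 * k \<in> P_indices k \<longleftrightarrow> m \<in> P_indices k)"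
proof (intro conjI allI impI)
  fix n
  have "P_genfun k $ n = hcoeff k (n + 1) $ n"
    using hcoeff_eq_P_genfun[of k n "n + 1"] assms by simp
  also have "\<dots> = S_gf k 0 $ n"
    using assms by (intro S_gf_eq_hcoeff[symmetric]) auto
  finally show "card {M \<in> partitions_of n. condP k M} = card {M \<in> partitions_of n. condS k M}"
    by (simp add: P_genfun_def S_gf_def part_gf_def)
next
  show "(\<lambda>m. if m \<in> P_indices k then inverse (1 - fps_X ^ m) else 1) has_prod P_genfun k"
    using assms by (intro P_genfun_has_prod) simp
next
  fix m :: nat assume "m \<ge> 1"
  then show "m + 4 * k \<in> P_indices k \<longleftrightarrow> m \<in> P_indices k"
    by (simp add: P_indices_def cong_def)
qed

end
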